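(* Let $\mathcal{A}$ be a finite dimensional C*-algebra and let $E$ be a Hilbert $\mathcal{A}$-module that is not finitely generated. If $S\in\mathcal{L}(E)$ commutes with a nonzero compact operator $K\in\mathcal{K}(E)$, then $S$ has a proper nonzero invariant submodule. In particular, every nonzero compact operator on a Hilbert $\mathcal{A}$-module that is not finitely generated has a proper nonzero invariant submodule.
   Context: Hilbert $\mathcal{A}$-modules are right Hilbert C*-modules $E$ over $\mathcal{A}$ with $\mathcal{A}$-valued inner product $\langle\cdot,\cdot\rangle$, linear in the second variable, complete in the norm $\|x\|=\|\langle x,x\rangle\|^{1/2}$. "Finitely generated" means finitely generated as a right $\mathcal{A}$-module. $\mathcal{L}(E)$ is the C*-algebra of all adjointable operators on $E$. For $x,y\in E$ let $\theta_{x,y}(z)=x\langle y,z\rangle$; $\mathcal{K}(E)$ is the operator-norm closure in $\mathcal{L}(E)$ of the linear span of $\{\theta_{x,y}:x,y\in E\}$, and its elements are called compact operators on $E$. A closed submodule $W$ of $E$ is an invariant submodule for $T\in\mathcal{L}(E)$ if $T(W)\subseteq W$. Proper nonzero means $\{0\}\neq W\neq E$. *)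

theory Defs
  imports "HOL-Analysis.Analysis"
begin

class complex_vector = real_vector +
  fixes scaleC :: "complex \<Rightarrow> 'a \<Rightarrow> 'a"  (infixr "*\<^sub>C" 75)
  assumes scaleC_add_right: "c *\<^sub>C (x + y) = c *\<^sub>C x + c *\<^sub>C y"
    and scaleC_add_left: "(c + d) *\<^sub>C x = c *\<^sub>C x + d *\<^sub>C x"
    and scaleC_scaleC: "c *\<^sub>C (d *\<^sub>C x) = (c * d) *\<^sub>C x"
    and scaleC_one: "1 *\<^sub>C x = x"
    and scaleR_scaleC: "r *\<^sub>R x = complex_of_real r *\<^sub>C x"

global_interpretation complex_vector: vector_space "scaleC :: complex \<Rightarrow> 'a \<Rightarrow> 'a::complex_vector"
  by unfold_locales (simp_all add: scaleC_add_right scaleC_add_left scaleC_scaleC scaleC_one)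

class complex_normed_vector = complex_vector + real_normed_vector +
  assumes norm_scaleC: "norm (c *\<^sub>C x) = cmod c * norm x"

text \<open>No unit is required, and the zero algebra is allowed.\<close>

class cstar_algebra = complex_normed_vector + real_normed_algebra + banach +
  fixes star :: "'a \<Rightarrow> 'a"
  assumes scaleC_mult_left: "(c *\<^sub>C a) * b = c *\<^sub>C (a * b)"
    and scaleC_mult_right: "a * (c *\<^sub>C b) = c *\<^sub>C (a * b)"
    and star_add: "star (a + b) = star a + star b"
    and star_scaleC: "star (c *\<^sub>C a) = cnj c *\<^sub>C star a"
    and star_mult: "star (a * b) = star b * star a"
    and star_star: "star (star a) = a"
    and cstar_identity: "norm (star a * a) = (norm a)\<^sup>2"

definition positive :: "'a::cstar_algebra \<Rightarrow> bool" where
  "positive a \<longleftrightarrow> (\<exists>b. a = star b * b)"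

text \<open>
  Right Hilbert modules. The norm of the carrier type is tied to the inner product by
  \<open>norm_eq\<close>, so that completeness is the class \<^class>\<open>banach\<close> and topological notions
  such as \<^const>\<open>closed\<close> and \<^const>\<open>onorm\<close> refer to the Hilbert module norm.
\<close>

locale hilbert_module =
  fixes act :: "'e::{complex_normed_vector, banach} \<Rightarrow> 'a::cstar_algebra \<Rightarrow> 'e"  (infixl "\<cdot>" 75)
    and ip :: "'e \<Rightarrow> 'e \<Rightarrow> 'a"
  assumes act_add_left: "(x + y) \<cdot> a = x \<cdot> a + y \<cdot> a"
    and act_add_right: "x \<cdot> (a + b) = x \<cdot> a + x \<cdot> b"
    and act_mult: "x \<cdot> (a * b) = (x \<cdot> a) \<cdot> b"
    and act_scaleC_left: "(c *\<^sub>C x) \<cdot> a = c *\<^sub>C (x \<cdot> a)"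
    and act_scaleC_right: "x \<cdot> (c *\<^sub>C a) = c *\<^sub>C (x \<cdot> a)"
    and ip_add_right: "ip x (y + z) = ip x y + ip x z"
    and ip_scaleC_right: "ip x (c *\<^sub>C y) = c *\<^sub>C ip x y"
    and ip_act_right: "ip x (y \<cdot> a) = ip x y * a"
    and ip_star: "star (ip x y) = ip y x"
    and ip_positive: "positive (ip x x)"
    and ip_definite: "ip x x = 0 \<Longrightarrow> x = 0"
    and norm_eq: "norm x = sqrt (norm (ip x x))"
begin

text \<open>
  The sums are taken without integer multiples of the generators. This is the submodule
  generated by \<open>G\<close> when the algebra is unital, which holds for every finite dimensional
  C*-algebra.
\<close>

definition finitely_generated :: bool where
  "finitely_generated \<longleftrightarrow> (\<exists>G. finite G \<and> (\<forall>x. \<exists>a. x = (\<Sum>g\<in>G. g \<cdot> a g)))"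

definition closed_submodule :: "'e set \<Rightarrow> bool" where
  "closed_submodule W \<longleftrightarrow>
     complex_vector.subspace W \<and> (\<forall>x\<in>W. \<forall>a. x \<cdot> a \<in> W) \<and> closed W"

text \<open>The set \<open>\<L>(E)\<close>; linearity and boundedness of its elements are automatic.\<close>

definition adjointable_ops :: "('e \<Rightarrow> 'e) set" where
  "adjointable_ops = {T. \<exists>T'. \<forall>x y. ip (T x) y = ip x (T' y)}"

definition theta :: "'e \<Rightarrow> 'e \<Rightarrow> 'e \<Rightarrow> 'e" where
  "theta x y z = x \<cdot> ip y z"

definition theta_span :: "('e \<Rightarrow> 'e) set" where
  "theta_span = {F. \<exists>(n::nat) c x y. F = (\<lambda>z. \<Sum>i<n. c i *\<^sub>C theta (x i) (y i) z)}"

text \<open>The set \<open>\<K>(E)\<close>, the closure of \<^const>\<open>theta_span\<close> in \<^const>\<open>adjointable_ops\<close>.\<close>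

definition compact_ops :: "('e \<Rightarrow> 'e) set" where
  "compact_ops =
     {K \<in> adjointable_ops. \<forall>\<epsilon>>0. \<exists>F\<in>theta_span. onorm (\<lambda>z. K z - F z) < \<epsilon>}"

definition invariant_submodule :: "('e \<Rightarrow> 'e) \<Rightarrow> 'e set \<Rightarrow> bool" where
  "invariant_submodule T W \<longleftrightarrow> closed_submodule W \<and> T ` W \<subseteq> W"

end

end

theory Submission
  imports Defs
begin

text \<open>
  Since the algebra is finite dimensional, the operators \<open>\<theta>\<^sub>x\<^sub>,\<^sub>y\<close> have finite dimensional range, so
  the elements of \<open>\<K>(E)\<close> are compact operators on the Banach space \<open>E\<close>. A nonzero scalar operator
  in \<open>\<K>(E)\<close> would be within distance less than its modulus of an element of the span of the
  \<open>\<theta>\<^sub>x\<^sub>,\<^sub>y\<close>, which would then be surjective and make \<open>E\<close> finitely generated. So \<open>K\<close> is compact and not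
  a scalar, and by Lomonosov's theorem it has a nontrivial closed hyperinvariant subspace. The
  right multiplications by elements of the algebra commute with \<open>K\<close>, hence this subspace is a
  submodule, and it is invariant for \<open>S\<close>.
\<close>

section \<open>Complex normed spaces\<close>

lemma bounded_bilinear_scaleC:
  "bounded_bilinear (scaleC :: complex \<Rightarrow> 'a \<Rightarrow> 'a::complex_normed_vector)"
proof (rule bounded_bilinear.intro)
  fix r :: real and c :: complex and x :: 'a
  show "(r *\<^sub>R c) *\<^sub>C x = r *\<^sub>R (c *\<^sub>C x)" "c *\<^sub>C (r *\<^sub>R x) = r *\<^sub>R (c *\<^sub>C x)"
    by (simp_all add: scaleR_scaleC scaleC_scaleC scaleR_conv_of_real mult.commute)
  show "\<exists>K. \<forall>a b. norm (a *\<^sub>C (b::'a)) \<le> norm a * norm b * K"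
    by (rule exI[of _ 1]) (simp add: norm_scaleC)
qed (simp_all add: scaleC_add_left scaleC_add_right)

lemmas tendsto_scaleC = bounded_bilinear.tendsto[OF bounded_bilinear_scaleC]
lemmas scaleC_diff_right = bounded_bilinear.diff_right[OF bounded_bilinear_scaleC]
lemmas scaleC_diff_left = bounded_bilinear.diff_left[OF bounded_bilinear_scaleC]
lemmas scaleC_minus_left = bounded_bilinear.minus_left[OF bounded_bilinear_scaleC]

section \<open>Compactness in finite dimension and uniform boundedness\<close>

text \<open>Induction on \<open>B\<close>. For a new vector \<open>b\<close> outside the span of
  \<open>B\<close>, the induction hypothesis makes that span closed, so \<open>b\<close> has
  positive distance from it. This bounds the coefficients of \<open>b\<close> in the sequence, and
  subsequences are extracted first for the coefficients, then for the remainders.\<close>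

lemma bounded_imp_convergent_subseq_span:
  fixes B :: "'a::complex_normed_vector set"
  assumes "finite B"
  shows "bounded (range x) \<Longrightarrow> (\<And>n::nat. x n \<in> complex_vector.span B) \<Longrightarrow>
    \<exists>l\<in>complex_vector.span B. \<exists>r. strict_mono r \<and> (x \<circ> r) \<longlonglongrightarrow> l"
  using assms
proof (induction B arbitrary: x)
  case empty
  then have "x = (\<lambda>_. 0)" by auto
  then show ?case
    by (auto simp: o_def intro!: exI[of _ id] strict_mono_id)
next
  case (insert b B)
  show ?case
  proof (cases "b \<in> complex_vector.span B")
    case True
    then show ?thesis
      using insert by (metis complex_vector.span_redundant)
  next
    case False
    have "closed (complex_vector.span B)"
      unfolding closed_sequential_limits
    proof (intro allI impI, elim conjE)
      fix u l assume u: "\<forall>n. u n \<in> complex_vector.span B" and l: "u \<longlonglongrightarrow> l"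
      have "bounded (range u)"
        using l convergent_imp_bounded by blast
      then obtain l' r where "l' \<in> complex_vector.span B" "strict_mono r" "(u \<circ> r) \<longlonglongrightarrow> l'"
        using insert.IH[of u] u by blast
      then show "l \<in> complex_vector.span B"
        using LIMSEQ_subseq_LIMSEQ[OF l] LIMSEQ_unique by blast
    qed
    then have "open (- complex_vector.span B)"
      by (simp add: open_Compl)
    then obtain e where e: "e > 0" "ball b e \<subseteq> - complex_vector.span B"
      using False by (meson ComplI open_contains_ball)
    \<comment> \<open>For nonzero \<open>c\<close>, the vector
      \<open>- (inverse c *\<^sub>C u)\<close> lies in the span and so has distance at least
      \<open>e\<close> from \<open>b\<close>; scale by \<open>c\<close>.\<close>
    have dist: "cmod c * e \<le> norm (c *\<^sub>C b + u)" if u: "u \<in> complex_vector.span B" for c u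
    proof (cases "c = 0")
      case False
      have "- (inverse c *\<^sub>C u) \<in> complex_vector.span B"
        using u by (simp add: complex_vector.span_neg complex_vector.span_scale)
      with e have "e \<le> dist b (- (inverse c *\<^sub>C u))"
        by (meson ComplD mem_ball not_less subsetD)
      then have "cmod c * e \<le> cmod c * norm (b + inverse c *\<^sub>C u)"
        by (simp add: dist_norm mult_left_mono)
      also have "\<dots> = norm (c *\<^sub>C b + u)"
        using False by (simp add: norm_scaleC[symmetric] scaleC_add_right scaleC_scaleC scaleC_one)
      finally show ?thesis .
    qed simp
    have "\<forall>n. \<exists>c. x n - c *\<^sub>C b \<in> complex_vector.span B"
      using insert.prems(2) by (simp add: complex_vector.span_breakdown_eq)
    then obtain c where c: "\<And>n. x n - c n *\<^sub>C b \<in> complex_vector.span B"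
      by metis
    obtain D where D: "\<And>n. norm (x n) \<le> D"
      using insert.prems(1) by (auto simp: bounded_iff)
    have cD: "cmod (c n) \<le> D / e" for n
    proof -
      have "cmod (c n) * e \<le> norm (x n)"
        using dist[OF c[of n], of "c n"] by simp
      then show ?thesis
        using D[of n] e by (simp add: pos_le_divide_eq)
    qed
    then have "bounded (range c)"
      by (auto simp: bounded_iff)
    then obtain l r where r: "strict_mono r" "(c \<circ> r) \<longlonglongrightarrow> l"
      using bounded_imp_convergent_subsequence by blast
    have "norm (x n - c n *\<^sub>C b) \<le> D + D / e * norm b" for n
      using norm_triangle_ineq4[of "x n" "c n *\<^sub>C b"] D[of n]
        mult_right_mono[OF cD[of n], of "norm b"] by (simp add: norm_scaleC)
    then have "bounded (range (\<lambda>n. x (r n) - c (r n) *\<^sub>C b))"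
      by (auto simp: bounded_iff)
    from insert.IH[OF this c] obtain l' s where
      s: "l' \<in> complex_vector.span B" "strict_mono s" "((\<lambda>n. x (r n) - c (r n) *\<^sub>C b) \<circ> s) \<longlonglongrightarrow> l'"
      by blast
    have "(c \<circ> r \<circ> s) \<longlonglongrightarrow> l"
      using r(2) s(2) by (rule LIMSEQ_subseq_LIMSEQ)
    from tendsto_add[OF s(3) tendsto_scaleC[OF this tendsto_const[of b]]]
    have "(x \<circ> (r \<circ> s)) \<longlonglongrightarrow> l' + l *\<^sub>C b"
      by (simp add: o_def)
    moreover have "l' + l *\<^sub>C b \<in> complex_vector.span (insert b B)"
      using s(1) by (auto simp: complex_vector.span_breakdown_eq intro!: exI[of _ l])
    ultimately show ?thesis
      using strict_mono_o[OF r(1) s(2)] by blast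
  qed
qed

lemma compact_cball_finite_dim:
  fixes B :: "'a::complex_normed_vector set"
  assumes "finite B" "complex_vector.span B = UNIV"
  shows "compact (cball (0::'a) R)"
  unfolding compact_eq_seq_compact_metric
proof (rule seq_compactI)
  fix x :: "nat \<Rightarrow> 'a" assume x: "\<forall>n. x n \<in> cball 0 R"
  then have "bounded (range x)"
    by (auto simp: bounded_iff)
  then obtain l r where "strict_mono r" "(x \<circ> r) \<longlonglongrightarrow> l"
    using bounded_imp_convergent_subseq_span[OF assms(1), of x] assms(2) by auto
  then show "\<exists>l\<in>cball 0 R. \<exists>r. strict_mono r \<and> (x \<circ> r) \<longlonglongrightarrow> l"
    using x by (metis closed_cball closed_sequentially comp_apply)
qed

text \<open>By Baire, one of the closed sets \<open>A n\<close> covering the space contains a ball.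
  The lemma serves to show that adjointable operators are bounded.\<close>

lemma uniform_boundedness:
  fixes f :: "'i \<Rightarrow> 'a::banach \<Rightarrow> 'b::real_normed_vector"
  assumes f: "\<And>i. i \<in> I \<Longrightarrow> bounded_linear (f i)"
    and bdd: "\<And>x. \<exists>C. \<forall>i\<in>I. norm (f i x) \<le> C"
  shows "\<exists>C. \<forall>i\<in>I. \<forall>x. norm (f i x) \<le> C * norm x"
proof -
  define A where "A n = (\<Inter>i\<in>I. {x. norm (f i x) \<le> real n})" for n
  have closed: "closed (A n)" for n
    unfolding A_def
    by (intro closed_INT ballI closed_Collect_le continuous_intros
        linear_continuous_on f)
  have un: "(\<Union>n. A n) = UNIV"
  proof (rule set_eqI, simp)
    fix x
    obtain C where "\<forall>i\<in>I. norm (f i x) \<le> C" using bdd by blast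
    moreover obtain n where "C \<le> real n" using real_arch_simple by blast
    ultimately show "\<exists>n. x \<in> A n" by (auto simp: A_def intro!: exI[of _ n])
  qed
  have "\<exists>n. interior (A n) \<noteq> {}"
  proof (rule ccontr)
    assume "\<not> ?thesis"
    then have "euclidean interior_of \<Union>(range A) = ({}::'a set)"
      using Met_TC.metric_Baire_category_alt[of "range A"] closed
      by (auto simp: complete_UNIV)
    then show False using un by simp
  qed
  then obtain n a where "a \<in> interior (A n)" by blast
  then obtain e where e: "e > 0" "cball a e \<subseteq> A n"
    by (meson interior_subset open_contains_cball open_interior order_trans)
  have "norm (f i x) \<le> (2 * real n / e) * norm x" if i: "i \<in> I" for i x
  proof (cases "x = 0")
    case True
    then show ?thesis by (simp add: linear_simps(3)[OF f[OF i]])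
  next
    case False
    interpret bounded_linear "f i" by (rule f[OF i])
    \<comment> \<open>Rescaled to norm \<open>e\<close>, so that \<open>a + u\<close> stays in the
      ball and \<open>f i u\<close> is a difference of two values bounded by
      \<open>n\<close>.\<close>
    define u where "u = (e / norm x) *\<^sub>R x"
    have "norm u = e" using False e by (simp add: u_def)
    then have "a \<in> A n" "a + u \<in> A n"
      using e by (auto intro!: subsetD[OF e(2)] simp: dist_norm)
    then have "norm (f i a) \<le> real n" "norm (f i (a + u)) \<le> real n"
      using i by (auto simp: A_def)
    then have "norm (f i u) \<le> 2 * real n"
      using norm_triangle_ineq4[of "f i (a + u)" "f i a"] by (simp add: add)
    then show ?thesis
      using False e by (simp add: u_def scaleR field_simps)
  qed
  then show ?thesis by blast
qed

section \<open>Compact operators between normed spaces\<close>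

definition bounded_clinear :: "('e::complex_normed_vector \<Rightarrow> 'f::complex_normed_vector) \<Rightarrow> bool" where
  "bounded_clinear f \<longleftrightarrow> bounded_linear f \<and> (\<forall>c x. f (c *\<^sub>C x) = c *\<^sub>C f x)"

definition compact_op :: "('e::real_normed_vector \<Rightarrow> 'f::real_normed_vector) \<Rightarrow> bool" where
  "compact_op f \<longleftrightarrow> compact (closure (f ` cball 0 1))"

lemma compact_opI:
  assumes "f ` cball 0 1 \<subseteq> C" "compact C"
  shows "compact_op f"
proof -
  have "closure (f ` cball 0 1) \<subseteq> C"
    using assms by (simp add: closure_minimal compact_imp_closed)
  then show ?thesis
    unfolding compact_op_def using assms(2) by (metis closed_closure compact_Int_closed inf.absorb_iff2)
qed

lemma compact_op_zero: "compact_op (\<lambda>_. 0)"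
  by (rule compact_opI[of _ "{0}"]) auto

lemma compact_op_add:
  assumes "compact_op f" "compact_op g"
  shows "compact_op (\<lambda>x. f x + g x)"
proof (rule compact_opI)
  let ?C = "{u + v |u v. u \<in> closure (f ` cball 0 1) \<and> v \<in> closure (g ` cball 0 1)}"
  show "compact ?C"
    using assms unfolding compact_op_def by (rule compact_sums)
  show "(\<lambda>x. f x + g x) ` cball 0 1 \<subseteq> ?C"
    using closure_subset[of "f ` cball 0 1"] closure_subset[of "g ` cball 0 1"] by blast
qed

lemma compact_op_sum:
  assumes "\<And>i. i \<in> I \<Longrightarrow> compact_op (f i)"
  shows "compact_op (\<lambda>x. \<Sum>i\<in>I. f i x)"
  using assms
  by (induction I rule: infinite_finite_induct) (simp_all add: compact_op_zero compact_op_add)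

text \<open>A finite \<open>e/3\<close>-net for the image under a nearby compact \<open>F\<close>
  serves, with a larger radius, as a net for the image under \<open>K\<close>.\<close>

lemma compact_op_approx:
  fixes K :: "'e::real_normed_vector \<Rightarrow> 'f::banach"
  assumes "\<And>\<epsilon>. \<epsilon> > 0 \<Longrightarrow> \<exists>F. compact_op F \<and> (\<forall>x\<in>cball 0 1. norm (K x - F x) \<le> \<epsilon>)"
  shows "compact_op K"
  unfolding compact_op_def compact_eq_totally_bounded
proof (intro conjI allI impI)
  show "complete (closure (K ` cball 0 1))"
    by (simp add: complete_eq_closed)
  fix e :: real assume e: "e > 0"
  then obtain F where F: "compact_op F" "\<And>x. x \<in> cball 0 1 \<Longrightarrow> norm (K x - F x) \<le> e/3"
    using assms[of "e/3"] by auto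
  obtain k where k: "finite k" "closure (F ` cball 0 1) \<subseteq> (\<Union>x\<in>k. ball x (e/3))"
    using F(1) e unfolding compact_op_def compact_eq_totally_bounded by (metis divide_pos_pos zero_less_numeral)
  \<comment> \<open>Closed balls make the finite union closed, so it also contains the closure; the
    slack between \<open>2*e/3\<close> and \<open>e\<close> then gives back open balls.\<close>
  have "K ` cball 0 1 \<subseteq> (\<Union>x\<in>k. cball x (2*e/3))"
  proof clarify
    fix x :: 'e assume x: "x \<in> cball 0 1"
    then obtain y where y: "y \<in> k" "dist y (F x) < e/3"
      using k(2) closure_subset[of "F ` cball 0 1"] by fastforce
    moreover have "dist (F x) (K x) \<le> e/3"
      using F(2)[OF x] by (simp add: dist_norm norm_minus_commute)
    ultimately have "dist y (K x) \<le> 2*e/3"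
      using dist_triangle[of y "K x" "F x"] by linarith
    then show "K x \<in> (\<Union>x\<in>k. cball x (2*e/3))"
      using y by auto
  qed
  then have "closure (K ` cball 0 1) \<subseteq> (\<Union>x\<in>k. cball x (2*e/3))"
    using k(1) by (intro closure_minimal) auto
  also have "\<dots> \<subseteq> (\<Union>x\<in>k. ball x e)"
    using e by fastforce
  finally show "\<exists>k. finite k \<and> closure (K ` cball 0 1) \<subseteq> (\<Union>x\<in>k. ball x e)"
    using k(1) by blast
qed

section \<open>Hyperinvariant subspaces of compact operators\<close>

lemma bounded_clinear_compose:
  assumes "bounded_clinear f" "bounded_clinear g"
  shows "bounded_clinear (f \<circ> g)"
  using assms bounded_linear_compose[of f g] by (auto simp: bounded_clinear_def o_def)

lemma bounded_clinear_add:
  assumes "bounded_clinear f" "bounded_clinear g"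
  shows "bounded_clinear (\<lambda>x. f x + g x)"
  using assms by (auto simp: bounded_clinear_def scaleC_add_right intro: bounded_linear_add)

lemma bounded_clinear_scaleC:
  assumes "bounded_clinear f"
  shows "bounded_clinear (\<lambda>x. c *\<^sub>C f x)"
  using assms
    bounded_linear_compose[OF bounded_bilinear.bounded_linear_right[OF bounded_bilinear_scaleC, of c], of f]
  by (auto simp: bounded_clinear_def scaleC_scaleC mult.commute)

lemma bounded_clinear_id: "bounded_clinear id"
  by (simp add: bounded_clinear_def id_def bounded_linear_ident)

lemma bounded_clinear_funpow:
  fixes f :: "'e::complex_normed_vector \<Rightarrow> 'e"
  assumes "bounded_clinear f"
  shows "bounded_clinear (f ^^ n)"
  using assms by (induction n) (auto intro: bounded_clinear_compose bounded_clinear_id)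

lemma bounded_clinear_pos_bounded:
  assumes "bounded_clinear f"
  obtains b where "b > 0" "\<And>x. norm (f x) \<le> b * norm x"
  using assms bounded_linear.pos_bounded[of f] by (metis bounded_clinear_def mult.commute)

lemma complex_subspace_closure:
  assumes "complex_vector.subspace (S :: 'a::complex_normed_vector set)"
  shows "complex_vector.subspace (closure S)"
  unfolding complex_vector.subspace_def
proof (intro conjI ballI allI)
  show "0 \<in> closure S"
    using assms closure_subset complex_vector.subspace_0 by blast
  fix x y c assume "x \<in> closure S" "y \<in> closure S"
  then obtain u v where u: "\<And>n. u n \<in> S" "u \<longlonglongrightarrow> x" and v: "\<And>n. v n \<in> S" "v \<longlonglongrightarrow> y"
    by (metis closure_sequential)
  show "x + y \<in> closure S"
    unfolding closure_sequential
    using u v assms by (intro exI[of _ "\<lambda>n. u n + v n"]) (auto intro: tendsto_add complex_vector.subspace_add)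
next
  fix x c assume "x \<in> closure S"
  then obtain u where u: "\<And>n. u n \<in> S" "u \<longlonglongrightarrow> x"
    by (metis closure_sequential)
  show "c *\<^sub>C x \<in> closure S"
    unfolding closure_sequential
    using u assms
    by (intro exI[of _ "\<lambda>n. c *\<^sub>C u n"]) (auto intro: tendsto_scaleC complex_vector.subspace_scale)
qed

section \<open>Resolvents and quasinilpotence\<close>

text \<open>If no uniform \<open>M\<close> existed, there would be unit vectors \<open>u n\<close>
  with \<open>u n - z n *\<^sub>C K (u n)\<close> tending to 0. Compactness of the disc and of
  \<open>K\<close> gives a subsequence with a limit of norm 1, which is an eigenvector for a nonzero
  eigenvalue.\<close>

lemma compact_op_resolvent_bound:
  fixes K :: "'e::complex_normed_vector \<Rightarrow> 'e"
  assumes K: "bounded_clinear K" "compact_op K"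
    and eig: "\<And>c x. c \<noteq> 0 \<Longrightarrow> K x = c *\<^sub>C x \<Longrightarrow> x = 0"
  obtains M where "M > 0" "\<And>z x. cmod z \<le> r \<Longrightarrow> norm x \<le> M * norm (x - z *\<^sub>C K x)"
proof -
  interpret K: bounded_linear K using K(1) by (simp add: bounded_clinear_def)
  have KC: "K (c *\<^sub>C x) = c *\<^sub>C K x" for c x using K(1) by (simp add: bounded_clinear_def)
  have "\<exists>n::nat. \<forall>z x. cmod z \<le> r \<longrightarrow> norm x \<le> real (Suc n) * norm (x - z *\<^sub>C K x)"
  proof (rule ccontr)
    assume "\<not> ?thesis"
    then have "\<forall>n::nat. \<exists>z x. cmod z \<le> r \<and> real (Suc n) * norm (x - z *\<^sub>C K x) < norm x"
      by (meson not_le)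
    then obtain z x where z: "\<And>n. cmod (z n) \<le> r"
      and x: "\<And>n. real (Suc n) * norm (x n - z n *\<^sub>C K (x n)) < norm (x n)"
      by metis
    define u where "u n = inverse (norm (x n)) *\<^sub>R x n" for n
    have x0: "norm (x n) > 0" for n
      using x[of n] by (meson le_less_trans mult_nonneg_nonneg norm_ge_zero of_nat_0_le_iff)
    then have u1: "norm (u n) = 1" for n
      by (simp add: u_def less_imp_neq[symmetric])
    define d where "d n = u n - z n *\<^sub>C K (u n)" for n
    have "d n = inverse (norm (x n)) *\<^sub>R (x n - z n *\<^sub>C K (x n))" for n
      by (simp add: d_def u_def K.scaleR scaleR_diff_right
          bounded_bilinear.scaleR_right[OF bounded_bilinear_scaleC])
    then have dn: "norm (d n) = norm (x n - z n *\<^sub>C K (x n)) / norm (x n)" for n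
      by (simp add: divide_inverse mult.commute)
    have "norm (d n) \<le> inverse (real (Suc n))" for n
      unfolding dn using x[of n] x0[of n] by (simp add: field_simps del: of_nat_Suc)
    then have d: "d \<longlonglongrightarrow> 0"
      by (intro Lim_null_comparison[OF _ LIMSEQ_inverse_real_of_nat]) simp
    have "compact (cball (0::complex) r \<times> closure (K ` cball 0 1))"
      using K(2) by (intro compact_Times) (auto simp: compact_op_def)
    moreover have "(z n, K (u n)) \<in> cball (0::complex) r \<times> closure (K ` cball 0 1)" for n
      using z[of n] u1[of n] closure_subset[of "K ` cball 0 1"] by auto
    ultimately obtain l s where s: "strict_mono s" "((\<lambda>n. (z n, K (u n))) \<circ> s) \<longlonglongrightarrow> l"
      using seq_compactE[OF compact_imp_seq_compact, of _ "\<lambda>n. (z n, K (u n))"] by blast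
    obtain w y where l: "l = (w, y)" by fastforce
    have zw: "(\<lambda>n. z (s n)) \<longlonglongrightarrow> w" and Ky: "(\<lambda>n. K (u (s n))) \<longlonglongrightarrow> y"
      using tendsto_fst[OF s(2)] tendsto_snd[OF s(2)] by (simp_all add: l o_def)
    have "(\<lambda>n. d (s n)) \<longlonglongrightarrow> 0"
      using LIMSEQ_subseq_LIMSEQ[OF d s(1)] by (simp add: o_def)
    from tendsto_add[OF this tendsto_scaleC[OF zw Ky]]
    have lim: "(\<lambda>n. u (s n)) \<longlonglongrightarrow> w *\<^sub>C y" by (simp add: d_def)
    \<comment> \<open>Norm 1 of the limit \<open>w *\<^sub>C y\<close> also forces \<open>w\<close>
      to be nonzero, so that \<open>inverse w\<close> is an eigenvalue.\<close>
    from tendsto_norm[OF this] have n1: "norm (w *\<^sub>C y) = 1"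
      by (simp add: u1 LIMSEQ_const_iff)
    have "y = K (w *\<^sub>C y)"
      using LIMSEQ_unique[OF Ky K.tendsto[OF lim]] .
    moreover have "w \<noteq> 0" using n1 by auto
    ultimately have "K (w *\<^sub>C y) = inverse w *\<^sub>C (w *\<^sub>C y)"
      by (simp add: scaleC_scaleC scaleC_one)
    then show False using eig[of "inverse w" "w *\<^sub>C y"] n1 \<open>w \<noteq> 0\<close> by simp
  qed
  then show ?thesis using that by (metis of_nat_0_less_iff zero_less_Suc)
qed

text \<open>Method of continuity along the segment from 0 to \<open>z\<close>.\<close>

lemma resolvent_surj:
  fixes K :: "'e::{complex_normed_vector, banach} \<Rightarrow> 'e"
  assumes K: "bounded_clinear K" and M: "M > 0"
    and bound: "\<And>z x. cmod z \<le> r \<Longrightarrow> norm x \<le> M * norm (x - z *\<^sub>C K x)"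
    and z: "cmod z \<le> r"
  shows "\<exists>x. x - z *\<^sub>C K x = y"
proof -
  interpret K: bounded_linear K using K by (simp add: bounded_clinear_def)
  obtain b where b: "b > 0" "\<And>x. norm (K x) \<le> b * norm x"
    using bounded_clinear_pos_bounded[OF K] by blast
  have step: "\<forall>y. \<exists>x. x - w *\<^sub>C K x = y"
    if v: "cmod v \<le> r" "\<And>y. \<exists>x. x - v *\<^sub>C K x = y" and wv: "cmod (w - v) * (M * b) \<le> 1/2" for v w
  proof
    fix y
    obtain R where R: "\<And>y. R y - v *\<^sub>C K (R y) = y" using v(2) by metis
    \<comment> \<open>A fixed point of \<open>g\<close> solves the equation at \<open>w\<close>;
      \<open>R\<close> is Lipschitz with constant \<open>M\<close>, so \<open>g\<close> contracts by
      1/2 when \<open>w\<close> is near \<open>v\<close>.\<close>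
    define g where "g x = R (y + (w - v) *\<^sub>C K x)" for x
    have "dist (g x) (g x') \<le> 1/2 * dist x x'" for x x'
    proof -
      have "norm (g x - g x') \<le> M * norm ((g x - g x') - v *\<^sub>C K (g x - g x'))"
        using bound v(1) by blast
      also have "(g x - g x') - v *\<^sub>C K (g x - g x')
          = (g x - v *\<^sub>C K (g x)) - (g x' - v *\<^sub>C K (g x'))"
        by (simp add: K.diff scaleC_diff_right)
      also have "\<dots> = (w - v) *\<^sub>C K (x - x')"
        by (simp add: g_def R K.diff scaleC_diff_right)
      also have "M * norm \<dots> \<le> M * (cmod (w - v) * (b * norm (x - x')))"
        using M by (simp add: norm_scaleC mult_left_mono b)
      also have "\<dots> = cmod (w - v) * (M * b) * norm (x - x')" by simp
      also have "\<dots> \<le> 1/2 * norm (x - x')"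
        by (intro mult_right_mono wv) simp
      finally show ?thesis by (simp add: dist_norm)
    qed
    then obtain x where "g x = x" using banach_fix_type[of "1/2" g] by auto
    then have "x - v *\<^sub>C K x = y + (w - v) *\<^sub>C K x" using R[of "y + (w - v) *\<^sub>C K x"] by (simp add: g_def)
    then have "x - w *\<^sub>C K x = y" by (simp add: scaleC_diff_left algebra_simps)
    then show "\<exists>x. x - w *\<^sub>C K x = y" ..
  qed
  \<comment> \<open>Divides the segment finely enough for every increment, of modulus
    \<open>cmod z / Suc n\<close>, to satisfy the hypothesis of \<open>step\<close>.\<close>
  obtain n :: nat where n: "2 * cmod z * (M * b) \<le> real n" using real_arch_simple by blast
  let ?t = "\<lambda>i. complex_of_real (real i / real (Suc n)) * z"
  have "\<forall>y. \<exists>x. x - ?t i *\<^sub>C K x = y" if "i \<le> Suc n" for i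
    using that
  proof (induction i)
    case (Suc i)
    have "cmod (?t i) = real i / real (Suc n) * cmod z"
      by (simp only: norm_mult norm_of_real) simp
    also have "\<dots> \<le> 1 * cmod z"
      using Suc.prems by (intro mult_right_mono) auto
    finally have "cmod (?t i) \<le> r" using z by simp
    moreover have "?t (Suc i) - ?t i = complex_of_real (1 / real (Suc n)) * z"
      by (simp only: left_diff_distrib[symmetric] of_real_diff[symmetric]) (simp add: field_simps)
    then have diff: "cmod (?t (Suc i) - ?t i) = cmod z / real (Suc n)"
      by (simp only: norm_mult norm_of_real) simp
    have "cmod (?t (Suc i) - ?t i) * (M * b) \<le> 1/2"
      unfolding diff using n by (simp add: field_simps)
    ultimately show ?case using Suc by (intro step[of "?t i"]) auto
  qed simp
  from this[of "Suc n"] show ?thesis by simp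
qed

text \<open>
  The resolvents of the powers \<open>K ^^ 2 ^ k\<close> are averages of resolvents of \<open>K\<close>, by
  \<open>(1 - T\<^sup>2)\<inverse> = ((1 - T)\<inverse> + (1 + T)\<inverse>) / 2\<close>. Hence they are Lipschitz along rays with a
  constant independent of \<open>k\<close>.
\<close>

lemma dyadic_resolvents:
  fixes K :: "'e::complex_normed_vector \<Rightarrow> 'e"
  assumes K: "bounded_clinear K"
    and R: "\<forall>z x. cmod z \<le> r \<longrightarrow> R z (x - z *\<^sub>C K x) = x \<and> R z x - z *\<^sub>C K (R z x) = x"
    and lip: "\<forall>z w x. cmod z \<le> r \<longrightarrow> cmod w \<le> r \<longrightarrow> norm (R z x - R w x) \<le> L * cmod (z - w) * norm x"
  shows "\<exists>P. (\<forall>z x. cmod z \<le> r \<longrightarrow> P z (x - z ^ (2^k) *\<^sub>C (K ^^ (2^k)) x) = x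
        \<and> P z x - z ^ (2^k) *\<^sub>C (K ^^ (2^k)) (P z x) = x)
      \<and> (\<forall>s t w x. cmod w = 1 \<longrightarrow> 0 \<le> s \<longrightarrow> s \<le> r \<longrightarrow> 0 \<le> t \<longrightarrow> t \<le> r \<longrightarrow>
          norm (P (of_real s * w) x - P (of_real t * w) x) \<le> L * \<bar>s - t\<bar> * norm x)"
proof (induction k)
  case 0
  have "norm (R (of_real s * w) x - R (of_real t * w) x) \<le> L * \<bar>s - t\<bar> * norm x"
    if "cmod w = 1" "0 \<le> s" "s \<le> r" "0 \<le> t" "t \<le> r" for s t w x
  proof -
    have "of_real s * w - of_real t * w = of_real (s - t) * w" by (simp add: left_diff_distrib)
    then have "cmod (of_real s * w - of_real t * w) = \<bar>s - t\<bar>"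
      using that(1) by (simp only: norm_mult norm_of_real) simp
    then show ?thesis
      using lip[rule_format, of "of_real s * w" "of_real t * w" x] that by (simp add: norm_mult)
  qed
  then show ?case using R by (intro exI[of _ R]) simp
next
  case (Suc k)
  then obtain P where P: "\<And>z x. cmod z \<le> r \<Longrightarrow> P z (x - z ^ (2^k) *\<^sub>C (K ^^ (2^k)) x) = x"
      "\<And>z x. cmod z \<le> r \<Longrightarrow> P z x - z ^ (2^k) *\<^sub>C (K ^^ (2^k)) (P z x) = x"
    and lipP: "\<And>s t w x. cmod w = 1 \<Longrightarrow> 0 \<le> s \<Longrightarrow> s \<le> r \<Longrightarrow> 0 \<le> t \<Longrightarrow> t \<le> r \<Longrightarrow>
          norm (P (of_real s * w) x - P (of_real t * w) x) \<le> L * \<bar>s - t\<bar> * norm x"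
    by blast
  \<comment> \<open>A root of -1 of order \<open>2^k\<close>: replacing \<open>z\<close> by
    \<open>z * \<zeta>\<close> changes the sign of \<open>z ^ (2^k)\<close>, so
    \<open>P (z * \<zeta>)\<close> inverts 1 + T where \<open>P z\<close> inverts 1 - T.\<close>
  define \<zeta> where "\<zeta> = cis (pi / 2^k)"
  have \<zeta>: "cmod \<zeta> = 1" "\<zeta> ^ (2^k) = -1"
    by (simp_all only: \<zeta>_def Complex.DeMoivre norm_cis) simp
  define Q where "Q z x = (1/2) *\<^sub>R (P z x + P (z * \<zeta>) x)" for z x
  have half: "(1/2) *\<^sub>R ((x + u) + (x - u)) = x" for x u :: 'e
    by (simp add: scaleR_2[symmetric])
  have Q: "Q z (x - z ^ (2^Suc k) *\<^sub>C (K ^^ (2^Suc k)) x) = x"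
    "Q z x - z ^ (2^Suc k) *\<^sub>C (K ^^ (2^Suc k)) (Q z x) = x" if z: "cmod z \<le> r" for z x
  proof -
    define T where "T x = z ^ (2^k) *\<^sub>C (K ^^ (2^k)) x" for x
    have "bounded_clinear T"
      using bounded_clinear_scaleC[OF bounded_clinear_funpow[OF K]] by (simp add: T_def[abs_def])
    then interpret T: bounded_linear T by (simp add: bounded_clinear_def)
    have TT: "z ^ (2^Suc k) *\<^sub>C (K ^^ (2^Suc k)) x = T (T x)" for x
      using bounded_clinear_funpow[OF K, of "2^k"]
      by (simp add: T_def bounded_clinear_def scaleC_scaleC funpow_add mult_2 power_add)
    have z': "cmod (z * \<zeta>) \<le> r" using z \<zeta> by (simp add: norm_mult)
    have P1: "P z (x - T x) = x" "P z x - T (P z x) = x" for x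
      using P[OF z] by (simp_all add: T_def)
    have P2: "P (z * \<zeta>) (x + T x) = x" "P (z * \<zeta>) x + T (P (z * \<zeta>) x) = x" for x
      using P[OF z'] \<zeta> by (simp_all add: T_def power_mult_distrib scaleC_minus_left)
    \<comment> \<open>The two factorizations of 1 - T^2, each feeding one of the inverses.\<close>
    have "x - T (T x) = (x + T x) - T (x + T x)" "x - T (T x) = (x - T x) + T (x - T x)"
      by (simp_all add: T.add T.diff)
    then have "P z (x - T (T x)) = x + T x" "P (z * \<zeta>) (x - T (T x)) = x - T x"
      using P1(1) P2(1) by metis+
    then show "Q z (x - z ^ (2^Suc k) *\<^sub>C (K ^^ (2^Suc k)) x) = x"
      unfolding TT Q_def by (simp only: half)
    have "Q z x - T (T (Q z x)) = (1/2) *\<^sub>R ((P z x - T (T (P z x))) +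
        (P (z * \<zeta>) x - T (T (P (z * \<zeta>) x))))"
      by (simp add: Q_def T.add T.scaleR scaleR_add_right scaleR_diff_right)
    also have "P z x - T (T (P z x)) = (P z x - T (P z x)) + T (P z x - T (P z x))"
      by (simp add: T.diff)
    also have "\<dots> = x + T x" by (simp only: P1(2))
    also have "P (z * \<zeta>) x - T (T (P (z * \<zeta>) x)) =
        (P (z * \<zeta>) x + T (P (z * \<zeta>) x)) - T (P (z * \<zeta>) x + T (P (z * \<zeta>) x))"
      by (simp add: T.add)
    also have "\<dots> = x - T x" by (simp only: P2(2))
    finally show "Q z x - z ^ (2^Suc k) *\<^sub>C (K ^^ (2^Suc k)) (Q z x) = x"
      unfolding TT by (simp only: half)
  qed
  have "norm (Q (of_real s * w) x - Q (of_real t * w) x) \<le> L * \<bar>s - t\<bar> * norm x"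
    if st: "cmod w = 1" "0 \<le> s" "s \<le> r" "0 \<le> t" "t \<le> r" for s t w x
  proof -
    \<comment> \<open>Multiplication by \<open>\<zeta>\<close> carries a ray to a ray, so both
      summands of \<open>Q\<close> obey the same Lipschitz bound, and the average keeps the constant
      \<open>L\<close>.\<close>
    have w: "cmod (w * \<zeta>) = 1" using st \<zeta> by (simp add: norm_mult)
    have "Q (of_real s * w) x - Q (of_real t * w) x = (1/2) *\<^sub>R
        ((P (of_real s * w) x - P (of_real t * w) x)
          + (P (of_real s * (w * \<zeta>)) x - P (of_real t * (w * \<zeta>)) x))"
      by (simp add: Q_def mult.assoc scaleR_add_right scaleR_diff_right)
    then have "norm (Q (of_real s * w) x - Q (of_real t * w) x) = 1/2 * norm
        ((P (of_real s * w) x - P (of_real t * w) x)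
          + (P (of_real s * (w * \<zeta>)) x - P (of_real t * (w * \<zeta>)) x))"
      by simp
    moreover have "norm ((P (of_real s * w) x - P (of_real t * w) x)
          + (P (of_real s * (w * \<zeta>)) x - P (of_real t * (w * \<zeta>)) x))
        \<le> L * \<bar>s - t\<bar> * norm x + L * \<bar>s - t\<bar> * norm x"
      by (intro norm_triangle_mono lipP st w)
    ultimately show ?thesis by linarith
  qed
  then show ?case using Q by (intro exI[of _ Q]) blast
qed

text \<open>Without nonzero eigenvalues, 1 - zK is invertible for every \<open>z\<close>. The
  spectral radius is then controlled without holomorphic functions: decay of \<open>t ^ N\<close>
  times the norm of \<open>K ^^ N\<close> along \<open>N = 2^k\<close> is carried from
  \<open>t = 0\<close> to \<open>t = c\<close> in steps of fixed length, because the Lipschitz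
  constant of the dyadic resolvents does not depend on \<open>k\<close>.\<close>

lemma quasinilpotent_dyadic:
  fixes K :: "'e::{complex_normed_vector, banach} \<Rightarrow> 'e"
  assumes K: "bounded_clinear K" "compact_op K"
    and eig: "\<And>c x. c \<noteq> 0 \<Longrightarrow> K x = c *\<^sub>C x \<Longrightarrow> x = 0"
    and c: "c \<ge> 0" and e: "e > 0"
  shows "\<forall>\<^sub>F k in sequentially. \<forall>x. c ^ (2^k) * norm ((K ^^ (2^k)) x) \<le> e * norm x"
proof -
  \<comment> \<open>Leaves room beyond \<open>c\<close>, since \<open>step\<close> reaches only
    points strictly below \<open>r\<close>.\<close>
  define r where "r = c + 1"
  obtain M where M: "M > 0" "\<And>z x. cmod z \<le> r \<Longrightarrow> norm x \<le> M * norm (x - z *\<^sub>C K x)"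
    by (rule compact_op_resolvent_bound[OF K, of r]) (use eig in blast)+
  interpret K: bounded_linear K using K by (simp add: bounded_clinear_def)
  obtain b where b: "b > 0" "\<And>x. norm (K x) \<le> b * norm x"
    using bounded_clinear_pos_bounded[OF K(1)] by blast
  have "\<exists>x. x - z *\<^sub>C K x = y" if "cmod z \<le> r" for z y
    by (rule resolvent_surj[OF K(1) M(1) _ that]) (rule M(2))
  then obtain R where R: "\<And>z y. cmod z \<le> r \<Longrightarrow> R z y - z *\<^sub>C K (R z y) = y"
    by metis
  have R': "R z (x - z *\<^sub>C K x) = x" if "cmod z \<le> r" for z x
  proof -
    let ?v = "R z (x - z *\<^sub>C K x) - x"
    have "?v - z *\<^sub>C K ?v = 0"
      using R[OF that, of "x - z *\<^sub>C K x"] by (simp add: K.diff scaleC_diff_right algebra_simps)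
    then show ?thesis using M(2)[OF that, of ?v] by simp
  qed
  \<comment> \<open>From the resolvent identity R z - R w = (z - w) R z K R w: each resolvent
    contributes a factor \<open>M\<close>, and \<open>K\<close> contributes
    \<open>b\<close>.\<close>
  define L where "L = M * b * M"
  have L: "L > 0" using M b by (simp add: L_def)
  have lip: "norm (R z x - R w x) \<le> L * cmod (z - w) * norm x"
    if z: "cmod z \<le> r" and w: "cmod w \<le> r" for z w x
  proof -
    have "norm (R z x - R w x) \<le> M * norm ((R z x - R w x) - z *\<^sub>C K (R z x - R w x))"
      by (rule M(2)[OF z])
    also have "(R z x - R w x) - z *\<^sub>C K (R z x - R w x) = (z - w) *\<^sub>C K (R w x)"
    proof -
      have "(R z x - R w x) - z *\<^sub>C K (R z x - R w x)
          = (R z x - z *\<^sub>C K (R z x)) - (R w x - z *\<^sub>C K (R w x))"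
        by (simp add: K.diff scaleC_diff_right)
      also have "\<dots> = (R w x - w *\<^sub>C K (R w x)) - (R w x - z *\<^sub>C K (R w x))"
        by (simp only: R[OF z] R[OF w])
      finally show ?thesis by (simp add: scaleC_diff_left)
    qed
    also have "norm \<dots> \<le> cmod (z - w) * (b * norm (R w x))"
      by (simp add: norm_scaleC mult_left_mono b)
    also have "\<dots> \<le> cmod (z - w) * (b * (M * norm x))"
      using M(2)[OF w, of "R w x"] b by (intro mult_left_mono) (auto simp: R[OF w])
    finally show ?thesis using M(1) by (simp add: L_def mult_ac)
  qed
  have RR: "\<forall>z x. cmod z \<le> r \<longrightarrow> R z (x - z *\<^sub>C K x) = x \<and> R z x - z *\<^sub>C K (R z x) = x"
    using R R' by simp
  have LL: "\<forall>z w x. cmod z \<le> r \<longrightarrow> cmod w \<le> r \<longrightarrow>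
      norm (R z x - R w x) \<le> L * cmod (z - w) * norm x"
    using lip by simp
  define small where "small t \<longleftrightarrow>
    (\<forall>e>0. \<forall>\<^sub>F k in sequentially. \<forall>x. t ^ (2^k) * norm ((K ^^ (2^k)) x) \<le> e * norm x)" for t
  have step: "small u" if t: "small t" "0 \<le> t" "t \<le> u" "u < r" "u < t + 1 / (6 * L)" for t u
  proof -
    \<comment> \<open>A point strictly beyond \<open>u\<close>: a mere bound at \<open>s\<close>
      yields decay at \<open>u\<close> through the factor \<open>(u / s) ^ (2^k)\<close>.\<close>
    define s where "s = min r (t + 1 / (6 * L))"
    have s: "u < s" "s \<le> r" "L * \<bar>s - t\<bar> \<le> 1/6"
    proof -
      show "u < s" "s \<le> r" using t by (auto simp: s_def)
      then have "\<bar>s - t\<bar> \<le> 1 / (6 * L)" using t by (auto simp: s_def)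
      then show "L * \<bar>s - t\<bar> \<le> 1/6" using L by (simp add: field_simps)
    qed
    have tr: "t \<le> r" "0 < s" using t s by auto
    have "\<forall>\<^sub>F k in sequentially. \<forall>x. t ^ (2^k) * norm ((K ^^ (2^k)) x) \<le> 1/4 * norm x"
      using t(1) unfolding small_def by (rule allE[of _ "1/4"]) simp
    then have bdd: "\<forall>\<^sub>F k in sequentially. \<forall>y. s ^ (2^k) * norm ((K ^^ (2^k)) y) \<le> norm y"
    proof eventually_elim
      case (elim k)
      define N :: nat where "N = 2^k"
      obtain P where P': "\<forall>z x. cmod z \<le> r \<longrightarrow> P z (x - z ^ N *\<^sub>C (K ^^ N) x) = x
            \<and> P z x - z ^ N *\<^sub>C (K ^^ N) (P z x) = x"
        and lipP: "\<forall>s t w x. cmod w = 1 \<longrightarrow> 0 \<le> s \<longrightarrow> s \<le> r \<longrightarrow> 0 \<le> t \<longrightarrow> t \<le> r \<longrightarrow>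
          norm (P (of_real s * w) x - P (of_real t * w) x) \<le> L * \<bar>s - t\<bar> * norm x"
        using dyadic_resolvents[OF K(1) RR LL, of k] unfolding N_def by (elim exE conjE)
      have P: "P z (x - z ^ N *\<^sub>C (K ^^ N) x) = x" "P z x - z ^ N *\<^sub>C (K ^^ N) (P z x) = x"
        if "cmod z \<le> r" for z x
        using P' that by simp_all
      show ?case
      proof
        fix y
        \<comment> \<open>\<open>y\<close> and \<open>v\<close> are the resolvents at
          \<open>s\<close> and \<open>t\<close> applied to the same \<open>x\<close>. Smallness at
          \<open>t\<close> gives \<open>norm (v - x)\<close> at most a third of
          \<open>norm x\<close>, and the Lipschitz bound gives \<open>norm (y - v)\<close> at most a
          sixth. So \<open>norm (y - x)\<close> is at most half of \<open>norm x\<close>, hence at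
          most \<open>norm y\<close>; and it equals the quantity to be bounded.\<close>
        define x where "x = y - of_real s ^ N *\<^sub>C (K ^^ N) y"
        have y: "P (of_real s) x = y"
          using P(1)[of "of_real s" y] tr s by (simp add: x_def)
        define v where "v = P (of_real t) x"
        have "norm (y - v) \<le> 1/6 * norm x"
          using lipP[rule_format, of 1 s t x] mult_right_mono[OF s(3), of "norm x"] t(2) tr s(2)
          unfolding y[symmetric] v_def by simp
        moreover have "v - x = of_real t ^ N *\<^sub>C (K ^^ N) v"
          using P(2)[of "of_real t" x] t(2) tr by (simp add: v_def algebra_simps)
        then have vx: "norm (v - x) \<le> 1/4 * norm v"
          using elim[rule_format, of v] t(2) by (simp add: norm_scaleC norm_power N_def)
        moreover have "norm v \<le> norm x + norm (v - x)"
          using norm_triangle_sub by blast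
        moreover have "norm (y - x) \<le> norm (y - v) + norm (v - x)"
          using norm_triangle_ineq[of "y - v" "v - x"] by simp
        moreover have "norm x \<le> norm y + norm (y - x)"
          using norm_triangle_sub[of x y] by (simp add: norm_minus_commute)
        ultimately have "norm (y - x) \<le> norm y" by linarith
        moreover have "norm (y - x) = s ^ N * norm ((K ^^ N) y)"
          using tr by (simp add: x_def norm_scaleC norm_power)
        ultimately show "s ^ (2^k) * norm ((K ^^ (2^k)) y) \<le> norm y" by (simp add: N_def)
      qed
    qed
    show ?thesis
      unfolding small_def
    proof (intro allI impI)
      fix e :: real assume e: "e > 0"
      have "(\<lambda>n. (u / s) ^ n) \<longlonglongrightarrow> 0"
        using s t by (intro LIMSEQ_power_zero) auto
      moreover have "filterlim (\<lambda>k. 2^k :: nat) at_top sequentially"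
        by (rule filterlim_subseq) (simp add: strict_mono_def)
      ultimately have "(\<lambda>k. (u / s) ^ (2^k)) \<longlonglongrightarrow> 0"
        by (rule filterlim_compose)
      then have "\<forall>\<^sub>F k in sequentially. (u / s) ^ (2^k) < e"
        using e by (simp add: order_tendsto_iff)
      with bdd show "\<forall>\<^sub>F k in sequentially. \<forall>x. u ^ (2^k) * norm ((K ^^ (2^k)) x) \<le> e * norm x"
      proof eventually_elim
        case (elim k)
        show ?case
        proof
          fix x
          have "u ^ (2^k) * norm ((K ^^ (2^k)) x) = (u / s) ^ (2^k) * (s ^ (2^k) * norm ((K ^^ (2^k)) x))"
            using tr by (simp add: power_divide)
          also have "\<dots> \<le> e * norm x"
            using elim e tr by (intro mult_mono) auto
          finally show "u ^ (2^k) * norm ((K ^^ (2^k)) x) \<le> e * norm x" .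
        qed
      qed
    qed
  qed
  define \<delta> where "\<delta> = 1 / (12 * L)"
  have \<delta>: "\<delta> > 0" "\<delta> < 1 / (6 * L)" using L by (simp_all add: \<delta>_def field_simps)
  have "small t" if "0 \<le> t" "t < r" "t \<le> real n * \<delta>" for n t
    using that
  proof (induction n arbitrary: t)
    case 0
    then show ?case by (simp add: small_def zero_power)
  next
    case (Suc n)
    \<comment> \<open>The maximum keeps the starting point nonnegative; the base case leaves only
      \<open>t = 0\<close>.\<close>
    have "small (max 0 (t - \<delta>))"
      using Suc \<delta> by (intro Suc.IH) (auto simp: algebra_simps)
    then show ?case
      using Suc.prems \<delta> by (intro step[of "max 0 (t - \<delta>)" t]) auto
  qed
  moreover obtain n :: nat where "c / \<delta> \<le> real n" using real_arch_simple by blast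
  ultimately have "small c"
    using c \<delta> by (simp add: r_def field_simps)
  then show ?thesis using e by (simp add: small_def)
qed

section \<open>Lomonosov's theorem\<close>

text \<open>
  Lomonosov's theorem, by Hilden's argument: if every orbit of the commutant is dense, finitely
  many operators of the commutant bring \<open>K x\<close> back into a ball around a point \<open>x\<^sub>0\<close>, for
  all \<open>x\<close> in that ball. Iterating, elements of the commutant of norm at most \<open>c ^ n\<close> map
  \<open>(K ^^ n) x\<^sub>0\<close> into the ball, which is impossible for quasinilpotent \<open>K\<close>.
\<close>

theorem compact_op_hyperinvariant_subspace:
  fixes K :: "'e::{complex_normed_vector, banach} \<Rightarrow> 'e"
  assumes K: "bounded_clinear K" "compact_op K"
    and nonscalar: "\<And>c. K \<noteq> (\<lambda>x. c *\<^sub>C x)"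
  obtains W where "complex_vector.subspace W" "closed W" "W \<noteq> {0}" "W \<noteq> UNIV"
    "\<And>T. bounded_clinear T \<Longrightarrow> T \<circ> K = K \<circ> T \<Longrightarrow> T ` W \<subseteq> W"
proof (cases "\<exists>c x. c \<noteq> 0 \<and> x \<noteq> 0 \<and> K x = c *\<^sub>C x")
  case True
  then obtain c x where cx: "c \<noteq> 0" "x \<noteq> 0" "K x = c *\<^sub>C x" by blast
  interpret K: bounded_linear K using K by (simp add: bounded_clinear_def)
  \<comment> \<open>An eigenspace for a nonzero eigenvalue is hyperinvariant, and it is proper
    because \<open>K\<close> is not scalar.\<close>
  let ?W = "{x. K x = c *\<^sub>C x}"
  show thesis
  proof (rule that[of ?W])
    show "complex_vector.subspace ?W"
      using K by (auto simp: complex_vector.subspace_def K.add scaleC_add_right K.zero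
          bounded_clinear_def scaleC_scaleC mult.commute)
    show "closed ?W"
      by (intro closed_Collect_eq linear_continuous_on K.bounded_linear_axioms
          bounded_bilinear.bounded_linear_right[OF bounded_bilinear_scaleC])
    show "?W \<noteq> {0}" using cx by blast
    show "?W \<noteq> UNIV" using nonscalar[of c] by blast
    show "T ` ?W \<subseteq> ?W" if "bounded_clinear T" "T \<circ> K = K \<circ> T" for T
      using that by (auto simp: bounded_clinear_def fun_eq_iff) metis
  qed
next
  case False
  interpret K: bounded_linear K using K by (simp add: bounded_clinear_def)
  define A where "A = {T. bounded_clinear T \<and> T \<circ> K = K \<circ> T}"
  have A_comp: "T \<circ> T' \<in> A" if "T \<in> A" "T' \<in> A" for T T'
    using that unfolding A_def by (auto intro: bounded_clinear_compose simp: fun_eq_iff)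
  have A_id: "id \<in> A" by (simp add: A_def bounded_clinear_id)
  \<comment> \<open>The closed orbit of \<open>y\<close> under the commutant \<open>A\<close> is a
    hyperinvariant subspace containing \<open>y\<close>, so only the case in which every nonzero
    \<open>y\<close> has a dense orbit remains.\<close>
  define W where "W y = closure ((\<lambda>T. T y) ` A)" for y
  have sub: "complex_vector.subspace (W y)" for y
    unfolding W_def
  proof (rule complex_subspace_closure)
    have "T y + T' y \<in> (\<lambda>T. T y) ` A" if "T \<in> A" "T' \<in> A" for T T'
      using that by (intro image_eqI[of _ _ "\<lambda>x. T x + T' x"])
        (auto simp: A_def fun_eq_iff K.add intro: bounded_clinear_add)
    moreover have "c *\<^sub>C T y \<in> (\<lambda>T. T y) ` A" if "T \<in> A" for c T
      using that K(1) by (intro image_eqI[of _ _ "\<lambda>x. c *\<^sub>C T x"])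
        (auto simp: A_def fun_eq_iff bounded_clinear_def[of K] intro: bounded_clinear_scaleC)
    moreover have "0 \<in> (\<lambda>T. T y) ` A"
      using bounded_clinear_scaleC[OF bounded_clinear_id, of 0]
      by (intro image_eqI[of _ _ "\<lambda>_. 0"]) (auto simp: A_def fun_eq_iff K.zero)
    ultimately show "complex_vector.subspace ((\<lambda>T. T y) ` A)"
      by (auto simp: complex_vector.subspace_def)
  qed
  have inv: "T ` W y \<subseteq> W y" if T: "bounded_clinear T" "T \<circ> K = K \<circ> T" for T y
  proof -
    have TA: "T \<in> A" using T by (simp add: A_def)
    show ?thesis
      unfolding W_def
    proof (rule image_closure_subset)
      show "continuous_on (closure ((\<lambda>T. T y) ` A)) T"
        using T by (intro linear_continuous_on) (simp add: bounded_clinear_def)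
      show "T ` (\<lambda>T. T y) ` A \<subseteq> closure ((\<lambda>T. T y) ` A)"
      proof clarify
        fix T' assume "T' \<in> A"
        with A_comp[OF TA] show "T (T' y) \<in> closure ((\<lambda>T. T y) ` A)"
          by (intro subsetD[OF closure_subset] image_eqI[of _ _ "T \<circ> T'"]) auto
      qed
    qed simp
  qed
  have yW: "y \<in> W y" for y
    unfolding W_def using A_id by (intro subsetD[OF closure_subset] image_eqI[of _ _ id]) auto
  show thesis
  proof (cases "\<exists>y. y \<noteq> 0 \<and> W y \<noteq> UNIV")
    case True
    then obtain y where y: "y \<noteq> 0" "W y \<noteq> UNIV" by blast
    show thesis
      using that[of "W y"] sub inv y yW[of y] by (auto simp: W_def)
  next
    case dense: False
    obtain x0 where x0: "K x0 \<noteq> 0"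
      using nonscalar[of 0] by (auto simp: fun_eq_iff)
    obtain \<rho>1 where \<rho>1: "\<rho>1 > 0" "\<And>x. dist x x0 < \<rho>1 \<Longrightarrow> dist (K x) (K x0) < norm (K x0) / 2"
      using K.isCont[OF continuous_ident, of x0] x0
      by (metis continuous_at_eps_delta half_gt_zero zero_less_norm_iff)
    have "x0 \<noteq> 0" using x0 by (auto simp: K.zero)
    \<comment> \<open>The bound by \<open>\<rho>1\<close> keeps the image of the ball away from 0,
      so that dense orbits are available on all of \<open>C\<close>; the bound by
      \<open>norm x0\<close> keeps 0 out of the ball itself, for the final contradiction.\<close>
    define \<rho> where "\<rho> = min (\<rho>1 / 2) (norm x0 / 2)"
    have \<rho>: "\<rho> > 0" "\<rho> < \<rho>1" "\<rho> < norm x0"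
      using \<rho>1(1) \<open>x0 \<noteq> 0\<close> by (auto simp: \<rho>_def min_less_iff_disj)
    define C where "C = closure (K ` cball x0 \<rho>)"
    have "0 \<notin> C"
    proof
      assume "0 \<in> C"
      moreover have "norm (K x0) / 2 > 0" using x0 by simp
      ultimately obtain y where "y \<in> K ` cball x0 \<rho>" "dist y 0 < norm (K x0) / 2"
        unfolding C_def closure_approachable by blast
      then obtain x where "x \<in> cball x0 \<rho>" "dist (K x) 0 < norm (K x0) / 2"
        by blast
      moreover from this have "dist x x0 < \<rho>1"
        using \<rho> by (simp add: dist_commute)
      then have "dist (K x) (K x0) < norm (K x0) / 2"
        by (rule \<rho>1)
      moreover have "dist 0 (K x0) \<le> dist (K x) 0 + dist (K x) (K x0)"
        by (metis dist_commute dist_triangle)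
      ultimately show False by simp
    qed
    have "compact C"
    proof -
      \<comment> \<open>Compactness of \<open>K\<close> concerns the unit ball; the ball around 0 of
        radius \<open>?s\<close> contains \<open>cball x0 \<rho>\<close>.\<close>
      let ?s = "\<rho> + norm x0"
      have s: "?s > 0" using \<rho> by (simp add: add_pos_nonneg)
      have "K ` cball x0 \<rho> \<subseteq> (\<lambda>v. ?s *\<^sub>R v) ` closure (K ` cball 0 1)"
      proof clarify
        fix x assume "x \<in> cball x0 \<rho>"
        then have "norm x \<le> ?s"
          using norm_triangle_sub[of x x0] by (simp add: dist_norm norm_minus_commute)
        then have "inverse ?s *\<^sub>R x \<in> cball 0 1"
          using s by (simp add: field_simps)
        then have "K (inverse ?s *\<^sub>R x) \<in> closure (K ` cball 0 1)"
          by (intro subsetD[OF closure_subset] imageI)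
        then show "K x \<in> (\<lambda>v. ?s *\<^sub>R v) ` closure (K ` cball 0 1)"
          using s by (intro image_eqI[of _ _ "K (inverse ?s *\<^sub>R x)"]) (auto simp: K.scaleR)
      qed
      moreover have "compact ((\<lambda>v. ?s *\<^sub>R v) ` closure (K ` cball 0 1))"
        using K(2) by (intro compact_scaling) (simp add: compact_op_def)
      ultimately show ?thesis
        unfolding C_def
        by (metis closed_closure closure_minimal compact_Int_closed compact_imp_closed inf.absorb_iff2)
    qed
    have "\<exists>T\<in>A. T y \<in> ball x0 \<rho>" if "y \<in> C" for y
    proof -
      have "y \<noteq> 0" using that \<open>0 \<notin> C\<close> by metis
      then have "W y = UNIV" using dense by metis
      then have "x0 \<in> closure ((\<lambda>T. T y) ` A)" by (simp add: W_def)
      then have "\<exists>v\<in>(\<lambda>T. T y) ` A. dist v x0 < \<rho>"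
        using \<rho>(1) unfolding closure_approachable by blast
      then show ?thesis by (auto simp: dist_commute)
    qed
    then have cover: "C \<subseteq> (\<Union>T\<in>A. T -` ball x0 \<rho>)" by blast
    have open_pre: "open (T -` ball x0 \<rho>)" if "T \<in> A" for T
      using that by (intro open_vimage linear_continuous_on) (auto simp: A_def bounded_clinear_def)
    obtain D where D: "D \<subseteq> A" "finite D" "C \<subseteq> (\<Union>T\<in>D. T -` ball x0 \<rho>)"
      by (rule compactE_image[OF \<open>compact C\<close> _ cover]) (use open_pre in blast)+
    have "\<forall>T\<in>D. \<exists>b. \<forall>x. norm (T x) \<le> b * norm x"
    proof
      fix T assume "T \<in> D"
      with D(1) have "bounded_clinear T" by (auto simp: A_def)
      then show "\<exists>b. \<forall>x. norm (T x) \<le> b * norm x"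
        by (metis bounded_clinear_pos_bounded)
    qed
    then obtain b where b: "\<And>T x. T \<in> D \<Longrightarrow> norm (T x) \<le> b T * norm x" by metis
    \<comment> \<open>The sum of absolute values dominates every constant of the finite family and
      is nonnegative in any case.\<close>
    define c where "c = (\<Sum>T\<in>D. \<bar>b T\<bar>)"
    have c: "c \<ge> 0" "norm (T x) \<le> c * norm x" if "T \<in> D" for T x
    proof -
      have "b T \<le> c"
        using member_le_sum[of T D "\<lambda>T. \<bar>b T\<bar>"] that D(2) by (simp add: c_def)
      then show "norm (T x) \<le> c * norm x"
        using b[OF that, of x] by (meson mult_right_mono norm_ge_zero order_trans)
    qed (simp add: c_def sum_nonneg)
    have c0: "c \<ge> 0" by (simp add: c_def sum_nonneg)
    have iter: "\<exists>T\<in>A. (\<forall>x. norm (T x) \<le> c ^ n * norm x) \<and> T ((K ^^ n) x0) \<in> cball x0 \<rho>" for n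
    proof (induction n)
      case 0
      show ?case using A_id \<rho> by (intro bexI[of _ id]) auto
    next
      case (Suc n)
      then obtain T where T: "T \<in> A" "\<And>x. norm (T x) \<le> c ^ n * norm x" "T ((K ^^ n) x0) \<in> cball x0 \<rho>"
        by blast
      \<comment> \<open>Applying \<open>K\<close> to a point of the ball lands in \<open>C\<close>,
        from where some member of \<open>D\<close> returns it to the ball. As \<open>T\<close>
        commutes with \<open>K\<close>, the new \<open>K\<close> joins the power.\<close>
      then have "K (T ((K ^^ n) x0)) \<in> C"
        unfolding C_def by (intro subsetD[OF closure_subset] imageI)
      then obtain T' where T': "T' \<in> D" "T' (K (T ((K ^^ n) x0))) \<in> ball x0 \<rho>"
        using D(3) by blast
      have comm: "K (T v) = T (K v)" for v
        using T(1) by (simp add: A_def fun_eq_iff)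
      have "norm ((T' \<circ> T) x) \<le> c ^ Suc n * norm x" for x
        using c(2)[OF T'(1), of "T x"] mult_left_mono[OF T(2)[of x] c0] by (simp add: mult.assoc)
      moreover have "(T' \<circ> T) ((K ^^ Suc n) x0) \<in> cball x0 \<rho>"
        using T'(2) by (simp add: comm)
      ultimately show ?case
        using A_comp T(1) T'(1) D(1) by (intro bexI[of _ "T' \<circ> T"]) auto
    qed
    \<comment> \<open>Makes \<open>e * norm x0\<close> half of \<open>norm x0 - \<rho>\<close>,
      while every point of the ball has norm at least \<open>norm x0 - \<rho>\<close>.\<close>
    define e where "e = (norm x0 - \<rho>) / (2 * norm x0)"
    have e: "e > 0" "e * norm x0 < norm x0 - \<rho>" using \<rho> \<open>x0 \<noteq> 0\<close> by (simp_all add: e_def)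
    have "\<forall>\<^sub>F k in sequentially. \<forall>x. c ^ (2^k) * norm ((K ^^ (2^k)) x) \<le> e * norm x"
      by (rule quasinilpotent_dyadic[OF K _ c0 e(1)]) (use False in blast)
    then obtain k where k: "\<And>x. c ^ (2^k) * norm ((K ^^ (2^k)) x) \<le> e * norm x"
      unfolding eventually_sequentially by blast
    obtain T where T: "\<And>x. norm (T x) \<le> c ^ (2^k) * norm x" "T ((K ^^ (2^k)) x0) \<in> cball x0 \<rho>"
      using iter[of "2^k"] by blast
    have "norm x0 - \<rho> \<le> norm (T ((K ^^ (2^k)) x0))"
      using T(2) norm_triangle_sub[of x0 "T ((K ^^ (2^k)) x0)"] by (simp add: dist_norm)
    also have "\<dots> \<le> e * norm x0"
      using T(1) k by (rule order_trans)
    finally show thesis using e(2) by simp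
  qed
qed

section \<open>Hilbert modules\<close>

context hilbert_module
begin

section \<open>Norm estimates for the inner product and the action\<close>

lemma star_norm: "norm (star a) = norm (a::'a)"
proof -
  have le: "norm b \<le> norm (star b)" for b :: 'a
  proof (cases "b = 0")
    case False
    have "norm b * norm b \<le> norm (star b) * norm b"
      using norm_mult_ineq[of "star b" b] by (simp add: cstar_identity power2_eq_square)
    then show ?thesis using False by simp
  qed simp
  show ?thesis using le[of a] le[of "star a"] by (simp add: star_star)
qed

lemma ip_add_left: "ip (x + y) z = ip x z + ip y z"
  by (metis ip_star ip_add_right star_add)

lemma ip_scaleC_left: "ip (c *\<^sub>C x) y = cnj c *\<^sub>C ip x y"
  by (metis ip_star ip_scaleC_right star_scaleC)

lemma ip_act_left: "ip (x \<cdot> a) y = star a * ip x y"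
  by (metis ip_star ip_act_right star_mult)

lemma ip_diff_left: "ip (x - y) z = ip x z - ip y z"
  using ip_add_left[of "x - y" y z] by (simp add: algebra_simps)

lemma norm_ip_self: "norm (ip x x) = (norm x)\<^sup>2"
  by (simp add: norm_eq)

lemma ip_eqI:
  assumes "\<And>y. ip x y = ip x' y"
  shows "x = x'"
proof -
  have "ip (x - x') (x - x') = 0" using assms by (simp add: ip_diff_left)
  then show ?thesis using ip_definite by fastforce
qed

text \<open>Polarization replaces the Cauchy--Schwarz inequality, at the price of a constant.\<close>

lemma norm_ip_le: "norm (ip y x) \<le> 4 * norm y * norm x"
proof (cases "x = 0 \<or> y = 0")
  case True
  have "ip y 0 = 0" "ip 0 x = 0"
    using ip_scaleC_right[of y 0 0] ip_scaleC_left[of 0 0 x] by simp_all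
  with True show ?thesis by auto
next
  case False
  define d where "d y x c = ip (y + c *\<^sub>C x) (y + c *\<^sub>C x)" for x y c
  have d: "d y x c = ip y y + c *\<^sub>C ip y x + cnj c *\<^sub>C ip x y + (c * cnj c) *\<^sub>C ip x x" for x y c
    by (simp add: d_def ip_add_left ip_add_right ip_scaleC_left ip_scaleC_right scaleC_add_right
        scaleC_scaleC mult.commute)
  \<comment> \<open>Polarization over the four fourth roots of unity.\<close>
  have polar: "d y x 1 - d y x (-1) - \<i> *\<^sub>C d y x \<i> + \<i> *\<^sub>C d y x (-\<i>) = 4 *\<^sub>C ip y x" for x y
  proof -
    have "4 *\<^sub>C ip y x = ip y x + ip y x + ip y x + ip y x"
      using scaleC_add_left[of 2 2 "ip y x"] scaleC_add_left[of 1 1 "ip y x"] by (simp add: scaleC_one)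
    then show ?thesis
      unfolding d by (simp add: scaleC_add_right scaleC_scaleC scaleC_minus_left scaleC_one scaleC_diff_right)
  qed
  have unit: "norm (ip y x) \<le> 4" if "norm x = 1" "norm y = 1" for x y
  proof -
    \<comment> \<open>Each polarization term is the square of a norm at most 2; the four of them add
      up to 16, and division by 4 leaves the constant 4.\<close>
    have le: "norm (d y x c) \<le> 4" if "cmod c = 1" for c
    proof -
      have "norm (y + c *\<^sub>C x) \<le> 2"
        using norm_triangle_ineq[of y "c *\<^sub>C x"] that \<open>norm x = 1\<close> \<open>norm y = 1\<close> by (simp add: norm_scaleC)
      from power_mono[OF this, of 2] show ?thesis by (simp add: d_def norm_ip_self)
    qed
    have "norm (d y x 1) \<le> 4" "norm (d y x (-1)) \<le> 4"
      "norm (\<i> *\<^sub>C d y x \<i>) \<le> 4" "norm (\<i> *\<^sub>C d y x (-\<i>)) \<le> 4"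
      by (simp_all add: norm_scaleC le)
    then have "norm (4 *\<^sub>C ip y x) \<le> 16"
      unfolding polar[symmetric] by norm
    then show ?thesis by (simp add: norm_scaleC)
  qed
  define u v where "u = complex_of_real (inverse (norm x)) *\<^sub>C x"
    and "v = complex_of_real (inverse (norm y)) *\<^sub>C y"
  have "norm (ip v u) \<le> 4"
    using False by (intro unit) (auto simp: u_def v_def norm_scaleC norm_inverse)
  moreover have "norm (ip v u) = norm (ip y x) / (norm y * norm x)"
    by (simp add: u_def v_def ip_scaleC_left ip_scaleC_right norm_scaleC norm_inverse norm_mult divide_inverse)
  ultimately show ?thesis
    using False by (simp add: field_simps)
qed

lemma norm_act_le: "norm (x \<cdot> a) \<le> norm x * norm a"
proof -
  have "(norm (x \<cdot> a))\<^sup>2 = norm (star a * (ip x x * a))"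
    by (simp add: norm_ip_self[symmetric] ip_act_left ip_act_right mult.assoc)
  also have "\<dots> \<le> norm (star a) * (norm (ip x x) * norm a)"
    by (meson mult_left_mono norm_ge_zero norm_mult_ineq order_trans)
  also have "\<dots> = (norm x * norm a)\<^sup>2"
    by (simp add: star_norm norm_ip_self power2_eq_square)
  finally show ?thesis
    by (rule power2_le_imp_le) simp
qed

lemma bounded_clinear_act_left: "bounded_clinear (\<lambda>x. x \<cdot> a)"
  unfolding bounded_clinear_def
proof
  show "bounded_linear (\<lambda>x. x \<cdot> a)"
    by (rule bounded_linear_intro[of _ "norm a"])
      (simp_all add: act_add_left act_scaleC_left scaleR_scaleC norm_act_le)
qed (simp add: act_scaleC_left)

lemma bounded_clinear_act_right: "bounded_clinear (\<lambda>a. x \<cdot> a)"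
  unfolding bounded_clinear_def
proof
  show "bounded_linear (\<lambda>a. x \<cdot> a)"
    by (rule bounded_linear_intro[of _ "norm x"])
      (simp_all add: act_add_right act_scaleC_right scaleR_scaleC norm_act_le mult.commute[of "norm _" "norm x"])
qed (simp add: act_scaleC_right)

lemma bounded_clinear_ip_right: "bounded_clinear (ip x)"
  unfolding bounded_clinear_def
proof
  show "bounded_linear (ip x)"
    by (rule bounded_linear_intro[of _ "4 * norm x"])
      (simp_all add: ip_add_right ip_scaleC_right scaleR_scaleC norm_ip_le mult.commute[of "norm _" "4 * norm x"])
qed (simp add: ip_scaleC_right)

section \<open>Adjointable operators\<close>

text \<open>Right multiplications thus commute with \<open>K\<close>, which later turns a
  hyperinvariant subspace into a submodule.\<close>

lemma adjointable_act:
  assumes "T \<in> adjointable_ops"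
  shows "T (x \<cdot> a) = T x \<cdot> a"
proof -
  obtain T' where T': "\<And>x y. ip (T x) y = ip x (T' y)"
    using assms by (auto simp: adjointable_ops_def)
  show ?thesis by (rule ip_eqI) (simp add: T' ip_act_left)
qed

text \<open>Linearity is tested under the inner product. For boundedness, uniform boundedness is
  applied to the maps \<open>ip (T x)\<close> with \<open>x\<close> in the unit ball: at each
  \<open>y\<close> they are bounded by a multiple of the norm of \<open>T' y\<close>.\<close>

lemma adjointable_bounded_clinear:
  assumes "T \<in> adjointable_ops"
  shows "bounded_clinear T"
proof -
  obtain T' where T': "\<And>x y. ip (T x) y = ip x (T' y)"
    using assms by (auto simp: adjointable_ops_def)
  have add: "T (x + y) = T x + T y" for x y
    by (rule ip_eqI) (simp add: T' ip_add_left)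
  have scale: "T (c *\<^sub>C x) = c *\<^sub>C T x" for c x
    by (rule ip_eqI) (simp add: T' ip_scaleC_left)
  have "\<exists>C. \<forall>x\<in>cball 0 1. \<forall>y. norm (ip (T x) y) \<le> C * norm y"
  proof (rule uniform_boundedness)
    fix y
    have "norm (ip (T x) y) \<le> 4 * norm (T' y)" if "x \<in> cball 0 1" for x
    proof -
      have "norm (ip (T x) y) \<le> 4 * norm x * norm (T' y)"
        unfolding T' by (rule norm_ip_le)
      also have "\<dots> \<le> 4 * 1 * norm (T' y)"
        using that by (intro mult_right_mono mult_left_mono) auto
      finally show ?thesis by simp
    qed
    then show "\<exists>C. \<forall>x\<in>cball 0 1. norm (ip (T x) y) \<le> C" by blast
  qed (use bounded_clinear_ip_right in \<open>auto simp: bounded_clinear_def\<close>)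
  then obtain C where C: "\<And>x y. norm x \<le> 1 \<Longrightarrow> norm (ip (T x) y) \<le> C * norm y"
    by (metis mem_cball_0)
  have unit: "norm (T x) \<le> \<bar>C\<bar>" if "norm x \<le> 1" for x
  proof (cases "T x = 0")
    case False
    \<comment> \<open>Insert \<open>y = T x\<close> and cancel one factor
      \<open>norm (T x)\<close>.\<close>
    then have "norm (T x) \<le> C"
      using C[OF that, of "T x"] by (simp add: norm_ip_self power2_eq_square)
    then show ?thesis by simp
  qed simp
  have "norm (T x) \<le> norm x * \<bar>C\<bar>" for x
  proof (cases "x = 0")
    case True
    then show ?thesis using scale[of 0 0] by simp
  next
    case False
    let ?c = "complex_of_real (inverse (norm x))"
    have "norm (T (?c *\<^sub>C x)) = norm (T x) / norm x"
      by (simp add: scale norm_scaleC norm_inverse divide_inverse)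
    then have "norm (T x) / norm x \<le> \<bar>C\<bar>"
      using False unit[of "?c *\<^sub>C x"] by (simp add: norm_scaleC norm_inverse)
    then show ?thesis
      using False by (simp add: field_simps)
  qed
  then have "bounded_linear T"
    by (intro bounded_linear_intro[of _ "\<bar>C\<bar>"]) (simp_all add: add scale scaleR_scaleC)
  then show ?thesis using scale by (simp add: bounded_clinear_def)
qed

section \<open>Compact operators on a Hilbert module\<close>

lemma theta_span_bounded_clinear:
  assumes "F \<in> theta_span"
  shows "bounded_clinear F"
proof -
  obtain n :: nat and c x y where F: "F = (\<lambda>z. \<Sum>i<n. c i *\<^sub>C theta (x i) (y i) z)"
    using assms by (auto simp: theta_span_def)
  have bl: "bounded_linear (\<lambda>z. c i *\<^sub>C (x i \<cdot> ip (y i) z))" for i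
  proof (rule bounded_linear_compose[OF bounded_bilinear.bounded_linear_right[OF bounded_bilinear_scaleC]])
    show "bounded_linear (\<lambda>z. x i \<cdot> ip (y i) z)"
      using bounded_clinear_act_right[of "x i"] bounded_clinear_ip_right[of "y i"]
      unfolding bounded_clinear_def by (blast intro: bounded_linear_compose)
  qed
  have "bounded_linear F"
    unfolding F theta_def by (intro bounded_linear_sum bl)
  then show ?thesis
    by (simp add: bounded_clinear_def F theta_def ip_scaleC_right act_scaleC_right
        complex_vector.scale_sum_right scaleC_scaleC mult.commute)
qed

text \<open>Each \<open>theta x y\<close> factors through the algebra as \<open>ip y\<close>
  followed by the action on \<open>x\<close>. The first map sends the unit ball into a ball of the
  algebra, which is compact by finite dimension.\<close>

lemma theta_span_compact_op:
  assumes B: "finite B" "complex_vector.span B = (UNIV::'a set)" and "F \<in> theta_span"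
  shows "compact_op F"
proof -
  obtain n :: nat and c x y where F: "F = (\<lambda>z. \<Sum>i<n. c i *\<^sub>C theta (x i) (y i) z)"
    using assms(3) by (auto simp: theta_span_def)
  show ?thesis
    unfolding F
  proof (intro compact_op_sum compact_opI)
    fix i
    let ?f = "\<lambda>a. c i *\<^sub>C (x i \<cdot> a)"
    have "norm (ip (y i) z) \<le> 4 * norm (y i)" if "norm z \<le> 1" for z
      using norm_ip_le[of "y i" z] mult_left_mono[OF that, of "4 * norm (y i)"] by simp
    then show "(\<lambda>z. c i *\<^sub>C theta (x i) (y i) z) ` cball 0 1 \<subseteq> ?f ` cball 0 (4 * norm (y i))"
      by (auto simp: theta_def)
    have "bounded_linear ?f"
      using bounded_clinear_act_right[of "x i"]
      by (intro bounded_linear_compose[OF bounded_bilinear.bounded_linear_right[OF bounded_bilinear_scaleC]])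
        (auto simp: bounded_clinear_def)
    then show "compact (?f ` cball 0 (4 * norm (y i)))"
      by (intro compact_continuous_image linear_continuous_on compact_cball_finite_dim[OF B])
  qed
qed

text \<open>Turns closeness in \<open>onorm\<close> into a pointwise estimate, which requires
  knowing that the difference is bounded linear.\<close>

lemma compact_ops_approx:
  assumes "K \<in> compact_ops" "e > 0"
  obtains F where "F \<in> theta_span" "\<And>z. norm (K z - F z) \<le> e * norm z"
proof -
  obtain F where F: "F \<in> theta_span" "onorm (\<lambda>z. K z - F z) < e"
    using assms by (auto simp: compact_ops_def)
  have "bounded_linear (\<lambda>z. K z - F z)"
    using adjointable_bounded_clinear[of K] theta_span_bounded_clinear[OF F(1)] assms(1)
    by (intro bounded_linear_sub) (auto simp: bounded_clinear_def compact_ops_def)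
  then have "norm (K z - F z) \<le> e * norm z" for z
    using onorm[of "\<lambda>z. K z - F z" z] F(2) mult_right_mono[of _ e "norm z"]
    by (meson less_imp_le norm_ge_zero order_trans)
  with F(1) that show ?thesis by blast
qed

lemma compact_ops_compact_op:
  assumes B: "finite B" "complex_vector.span B = (UNIV::'a set)" and K: "K \<in> compact_ops"
  shows "compact_op K"
proof (rule compact_op_approx)
  fix e :: real assume e: "e > 0"
  obtain F where F: "F \<in> theta_span" "\<And>z. norm (K z - F z) \<le> e * norm z"
    using compact_ops_approx[OF K e] by metis
  have "norm (K z - F z) \<le> e" if "z \<in> cball 0 1" for z
    using order_trans[OF F(2)[of z] mult_left_mono[of "norm z" 1 e]] that e by simp
  then show "\<exists>F. compact_op F \<and> (\<forall>x\<in>cball 0 1. norm (K x - F x) \<le> e)"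
    using theta_span_compact_op[OF B F(1)] by blast
qed

lemma theta_span_surj_finitely_generated:
  assumes "F \<in> theta_span" "surj F"
  shows finitely_generated
proof -
  obtain n :: nat and c x y where F: "F = (\<lambda>z. \<Sum>i<n. c i *\<^sub>C theta (x i) (y i) z)"
    using assms by (auto simp: theta_span_def)
  have "\<exists>a. v = (\<Sum>g\<in>x ` {..<n}. g \<cdot> a g)" for v
  proof -
    obtain z where "v = F z" using assms(2) by blast
    \<comment> \<open>The vectors \<open>x i\<close> may repeat, whereas finite generation sums over
      a set; so equal ones are grouped and their coefficients added.\<close>
    also have "F z = (\<Sum>g\<in>x ` {..<n}. \<Sum>i | i \<in> {..<n} \<and> x i = g. c i *\<^sub>C theta (x i) (y i) z)"
      unfolding F by (rule sum.image_gen) simp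
    also have "\<dots> = (\<Sum>g\<in>x ` {..<n}. g \<cdot> (\<Sum>i | i \<in> {..<n} \<and> x i = g. c i *\<^sub>C ip (y i) z))"
    proof (rule sum.cong[OF refl])
      fix g
      interpret bounded_linear "\<lambda>a. g \<cdot> a"
        using bounded_clinear_act_right[of g] by (simp add: bounded_clinear_def)
      show "(\<Sum>i | i \<in> {..<n} \<and> x i = g. c i *\<^sub>C theta (x i) (y i) z) =
        g \<cdot> (\<Sum>i | i \<in> {..<n} \<and> x i = g. c i *\<^sub>C ip (y i) z)"
        by (simp add: sum theta_def act_scaleC_right)
    qed
    finally show ?thesis
      by (intro exI[of _ "\<lambda>g. \<Sum>i | i \<in> {..<n} \<and> x i = g. c i *\<^sub>C ip (y i) z"])
  qed
  then show ?thesis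
    unfolding finitely_generated_def by (intro exI[of _ "x ` {..<n}"]) auto
qed

text \<open>An \<open>F\<close> in the span of the \<open>theta\<close> operators within
  \<open>cmod c / 2\<close> of the scalar \<open>c\<close> is surjective, by a contraction argument,
  and its range is finitely generated.\<close>

lemma compact_ops_scalar_finitely_generated:
  assumes "(\<lambda>z. c *\<^sub>C z) \<in> compact_ops" "c \<noteq> 0"
  shows finitely_generated
proof -
  have "cmod c / 2 > 0" using assms(2) by simp
  then obtain F where F: "F \<in> theta_span" "\<And>z. norm (c *\<^sub>C z - F z) \<le> cmod c / 2 * norm z"
    using compact_ops_approx[OF assms(1)] by blast
  interpret F: bounded_linear F
    using theta_span_bounded_clinear[OF F(1)] by (simp add: bounded_clinear_def)
  have "\<exists>x. F x = v" for v
  proof -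
    \<comment> \<open>Fixed points of \<open>g\<close> are exactly the solutions of
      \<open>F x = v\<close>; the distance from \<open>F\<close> to the scalar \<open>c\<close>
      gives the contraction factor 1/2.\<close>
    define g where "g x = inverse c *\<^sub>C (v + (c *\<^sub>C x - F x))" for x
    have "dist (g x) (g y) \<le> 1/2 * dist x y" for x y
    proof -
      have "g x - g y = inverse c *\<^sub>C (c *\<^sub>C (x - y) - F (x - y))"
        unfolding g_def scaleC_diff_right[symmetric]
        by (simp add: F.diff scaleC_diff_right algebra_simps)
      then have "norm (g x - g y) = inverse (cmod c) * norm (c *\<^sub>C (x - y) - F (x - y))"
        by (simp add: norm_scaleC norm_inverse)
      also have "\<dots> \<le> inverse (cmod c) * (cmod c / 2 * norm (x - y))"
        by (intro mult_left_mono F) simp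
      also have "\<dots> = 1/2 * norm (x - y)"
        using assms(2) by simp
      finally show ?thesis by (simp add: dist_norm)
    qed
    then obtain x where "g x = x"
      using banach_fix_type[of "1/2" g] by auto
    then have "c *\<^sub>C x = c *\<^sub>C g x" by simp
    also have "\<dots> = v + (c *\<^sub>C x - F x)"
      using assms(2) by (simp add: g_def scaleC_scaleC scaleC_one)
    finally show ?thesis by (intro exI[of _ x]) (simp add: algebra_simps)
  qed
  then have "surj F" by (metis surjI)
  then show ?thesis using theta_span_surj_finitely_generated F(1) by blast
qed

section \<open>Invariant submodules\<close>

theorem compact_commuting_invariant_submodule:
  assumes B: "finite B" "complex_vector.span B = (UNIV::'a set)"
    and nfg: "\<not> finitely_generated"
    and S: "S \<in> adjointable_ops" and K: "K \<in> compact_ops" "K \<noteq> (\<lambda>_. 0)" "S \<circ> K = K \<circ> S"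
  shows "\<exists>W. invariant_submodule S W \<and> W \<noteq> {0} \<and> W \<noteq> UNIV"
proof -
  have adj: "K \<in> adjointable_ops" using K(1) by (simp add: compact_ops_def)
  \<comment> \<open>The scalar 0 is excluded because \<open>K\<close> is nonzero, the other scalars
    because the module is not finitely generated.\<close>
  have "K \<noteq> (\<lambda>x. c *\<^sub>C x)" for c
    using compact_ops_scalar_finitely_generated[of c] nfg K by (cases "c = 0") auto
  then obtain W where W: "complex_vector.subspace W" "closed W" "W \<noteq> {0}" "W \<noteq> UNIV"
    "\<And>T. bounded_clinear T \<Longrightarrow> T \<circ> K = K \<circ> T \<Longrightarrow> T ` W \<subseteq> W"
    using compact_op_hyperinvariant_subspace[OF adjointable_bounded_clinear[OF adj]
          compact_ops_compact_op[OF B K(1)]] by metis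
  have "(\<lambda>x. x \<cdot> a) ` W \<subseteq> W" for a
    by (intro W bounded_clinear_act_left) (simp add: fun_eq_iff adjointable_act[OF adj])
  then have "closed_submodule W"
    using W by (auto simp: closed_submodule_def)
  moreover have "S ` W \<subseteq> W"
    by (intro W adjointable_bounded_clinear S K)
  ultimately show ?thesis
    using W by (auto simp: invariant_submodule_def)
qed

end

theorem corollary4p9:
  fixes act :: "'e::{complex_normed_vector, banach} \<Rightarrow> 'a::cstar_algebra \<Rightarrow> 'e"
    and ip :: "'e \<Rightarrow> 'e \<Rightarrow> 'a"
  assumes "\<exists>B::'a set. finite B \<and> complex_vector.span B = UNIV"
    and "hilbert_module act ip"
    and "\<not> hilbert_module.finitely_generated act"
  shows "(\<forall>S \<in> hilbert_module.adjointable_ops ip. \<forall>K \<in> hilbert_module.compact_ops act ip.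
            K \<noteq> (\<lambda>_. 0) \<and> S \<circ> K = K \<circ> S \<longrightarrow>
            (\<exists>W. hilbert_module.invariant_submodule act S W \<and> W \<noteq> {0} \<and> W \<noteq> UNIV))
       \<and> (\<forall>K \<in> hilbert_module.compact_ops act ip. K \<noteq> (\<lambda>_. 0) \<longrightarrow>
            (\<exists>W. hilbert_module.invariant_submodule act K W \<and> W \<noteq> {0} \<and> W \<noteq> UNIV))"
proof -
  interpret hilbert_module act ip by (rule assms(2))
  obtain B :: "'a set" where "finite B" "complex_vector.span B = UNIV"
    using assms(1) by blast
  note main = compact_commuting_invariant_submodule[OF this assms(3)]
  \<comment> \<open>For the second half: \<open>K\<close> itself plays the part of \<open>S\<close>,
    as it commutes with itself.\<close>
  have "K \<in> adjointable_ops" if "K \<in> compact_ops" for K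
    using that by (simp add: compact_ops_def)
  then show ?thesis
    using main by blast
qed

end
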